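(* Let $q$ be a prime power with $q \equiv 1 \pmod 2$, and let $c \in \mathbb{F}_{q^2}$ be such that $\left(\frac{c}{2}\right)^{\frac{q+1}{2}}=1$. Let $r,u,v$ be positive integers with $u$ and $v$ odd, and let $$h(x)=c+x^u\left(x^{\frac{q+1}{2}v}-1\right)\in\mathbb{F}_{q^2}[x].$$ Then the polynomial $f(x)=x^r h(x^{q-1})$ is a permutation polynomial of $\mathbb{F}_{q^2}$ if and only if $\gcd\left(r,\frac{q^2-1}{2}\right)=1$ and $\gcd\left(r-u,\frac{q+1}{2}\right)=1$.
   Context: $\mathbb{F}_{q^2}$ denotes the finite field with $q^2$ elements. A polynomial $f\in\mathbb{F}_{q^2}[x]$ is a permutation polynomial of $\mathbb{F}_{q^2}$ if the map $a\mapsto f(a)$ from $\mathbb{F}_{q^2}$ to itself is a bijection. *)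

theory Defs
  imports "HOL-Computational_Algebra.Polynomial" "HOL-Number_Theory.Cong"
    "HOL-Number_Theory.Prime_Powers" "HOL-Library.Cardinality"
begin

definition permutation_poly :: "'a :: {field, finite} poly \<Rightarrow> bool" where
  "permutation_poly f \<longleftrightarrow> bij (poly f)"

end

theory Submission
  imports Defs "HOL-Number_Theory.Residues"
begin

text \<open>
  Write \<open>d = c / 2\<close>. On nonzero squares \<open>f(x) = c x\<^sup>r\<close>, while on nonsquares
  \<open>f(x) = 2 x\<^sup>r (d - x\<^bsup>u(q-1)\<^esup>)\<close>. As \<open>d\<close> and \<open>x\<^bsup>q-1\<^esup>\<close> are \<open>(q+1)\<close>-th roots of unity,
  the Frobenius map \<open>t \<mapsto> t\<^sup>q\<close> inverts them, so \<open>f(x)\<^bsup>q-1\<^esup>\<close> is \<open>d\<^bsup>-2\<^esup> x\<^bsup>r(q-1)\<^esup>\<close> on squares and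
  \<open>-d\<^bsup>-1\<^esup> x\<^bsup>(r-u)(q-1)\<^esup>\<close> on nonsquares. Under the two gcd conditions \<open>r - u\<close> is even, hence
  \<open>(q+1)/2\<close> is odd, and this makes \<open>f\<close> preserve squares and nonsquares; injectivity on each
  class is then a matter of orders of elements. Conversely, an element of prime order violating
  one of the gcd conditions yields a collision of \<open>f\<close> among the squares or among the nonsquares.
\<close>

section \<open>Orders of elements and Frobenius in a finite field\<close>

lemma power_card_minus_1_eq_1:
  fixes x :: "'a :: {field, finite}"
  assumes "x \<noteq> 0"
  shows "x ^ (CARD('a) - 1) = 1"
proof -
  have "\<Prod>(UNIV - {0}) = (\<Prod>y\<in>UNIV - {0}. x * y)"
    by (rule prod.reindex_bij_witness[of _ "\<lambda>y. x * y" "\<lambda>y. y / x"]) (use assms in auto)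
  also have "\<dots> = x ^ (CARD('a) - 1) * \<Prod>(UNIV - {0})"
    by (simp add: prod.distrib)
  finally show ?thesis
    by simp
qed

text \<open>The polynomial \<open>X^n - 1\<close> has at most \<open>n\<close> roots, fewer than
  there are nonzero elements.\<close>

lemma exists_power_neq_1:
  assumes "0 < n" "n < CARD('a) - 1"
  obtains x :: "'a :: {field, finite}" where "x \<noteq> 0" "x ^ n \<noteq> 1"
proof -
  define p :: "'a poly" where "p = Polynomial.monom 1 n - 1"
  have "Polynomial.coeff p n = 1"
    using assms by (simp add: p_def)
  then have "p \<noteq> 0"
    by auto
  moreover have "Polynomial.degree p \<le> n"
    unfolding p_def by (intro degree_diff_le) (auto simp: degree_monom_le)
  ultimately have "card {x. poly p x = 0} \<le> n"
    using card_poly_roots_bound[of p] by simp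
  also have "\<dots> < card (UNIV - {0 :: 'a})"
    using assms by simp
  finally have "\<not> UNIV - {0 :: 'a} \<subseteq> {x. poly p x = 0}"
    by (meson card_mono finite linorder_not_less)
  then show ?thesis
    using that by (auto simp: p_def poly_monom)
qed

lemma power_int_gcd_eq_1:
  fixes x :: "'a :: field"
  assumes "x \<noteq> 0" "x powi a = 1" "x powi b = 1"
  shows "x powi gcd a b = 1"
proof -
  obtain s t where "s * a + t * b = gcd a b"
    using bezout_int by blast
  then have "x powi gcd a b = (x powi a) powi s * (x powi b) powi t"
    using assms(1) by (metis mult.commute power_int_add power_int_mult)
  then show ?thesis
    using assms by simp
qed

lemma power_coprime_eq_1:
  fixes x :: "'a :: field"
  assumes "x ^ a = 1" "x ^ b = 1" "coprime a b" "x \<noteq> 0"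
  shows "x = 1"
  using power_int_gcd_eq_1[of x "int a" "int b"] assms by (simp flip: gcd_int_int_eq)

text \<open>Since \<open>q\<close> is a power of the characteristic, the \<open>q\<close>-th power
  map is additive; applying this to \<open>(x - y) + y\<close> avoids evaluating
  \<open>(-1) ^ q\<close>.\<close>

lemma diff_power_primepow:
  fixes x y :: "'a :: {field, finite}"
  assumes "primepow q" "CARD('a) = q ^ 2"
  shows "(x - y) ^ q = x ^ q - y ^ q"
proof -
  obtain p k where p: "prime p" "q = p ^ k"
    using assms(1) unfolding primepow_def by blast
  have char: "prime CHAR('a)"
    by (rule prime_CHAR_semidom) (simp add: finite_imp_CHAR_pos)
  moreover have "CHAR('a) dvd q ^ 2"
    using CHAR_dvd_CARD[where ?'a = 'a] assms(2) by simp
  ultimately have "CHAR('a) dvd p"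
    using p prime_dvd_power by metis
  then have "CHAR('a) = p"
    using char p primes_dvd_imp_eq by blast
  then have "((x - y) + y) ^ q = (x - y) ^ q + y ^ q"
    using char p by (intro freshmans_dream') auto
  then show ?thesis
    by (simp add: algebra_simps)
qed

section \<open>The map on squares and nonsquares\<close>

locale binomial_type_map =
  fixes q r u :: nat and d :: "'a :: {field, finite}" and F :: "'a \<Rightarrow> 'a"
  assumes primepow_q: "primepow q" and odd_q: "odd q" and card_eq: "CARD('a) = q ^ 2"
    and d_power: "d ^ ((q + 1) div 2) = 1" and r_pos: "r > 0" and odd_u: "odd u"
    and F_eq: "\<And>x. F x = x ^ r * (2 * d + x ^ ((q - 1) * u) * (x ^ ((q ^ 2 - 1) div 2) - 1))"
begin

definition m where "m = (q + 1) div 2"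
text \<open>For nonzero \<open>x\<close>, \<open>x ^ M\<close> is the quadratic character: 1 on
  squares and -1 on nonsquares.\<close>

definition M where "M = (q ^ 2 - 1) div 2"

lemma q_gt_1: "q > 1"
  using primepow_q primepow_gt_Suc_0 by auto

lemma two_m: "2 * m = q + 1"
  using odd_q by (simp add: m_def)

lemma m_pos: "m > 0"
  using two_m by simp

lemma M_eq: "M = (q - 1) * m"
proof -
  have "q ^ 2 - 1 = (q - 1) * (q + 1)"
    using q_gt_1 by (simp add: power2_eq_square algebra_simps)
  then show ?thesis
    using two_m by (metis M_def mult.left_commute nonzero_mult_div_cancel_left zero_neq_numeral)
qed

lemma two_M: "2 * M = CARD('a) - 1"
  using odd_q by (simp add: M_def card_eq)

lemma M_pos: "M > 0"
  using M_eq m_pos q_gt_1 by simp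

lemma d_power_m: "d ^ m = 1"
  using d_power by (simp add: m_def)

lemma d_nonzero: "d \<noteq> 0"
  using d_power_m m_pos by (metis zero_power zero_neq_one)

lemma power_2M: "x \<noteq> 0 \<Longrightarrow> x ^ (2 * M) = 1" for x :: 'a
  unfolding two_M by (rule power_card_minus_1_eq_1)

lemma power_M_cases:
  fixes x :: 'a
  assumes "x \<noteq> 0"
  obtains "x ^ M = 1" | "x ^ M = -1"
  using power_2M[OF assms] by (metis mult.commute power_mult power2_eq_1_iff)

text \<open>Supplies elements of prime order: \<open>z ^ (2 * M div p)\<close> has order exactly
  \<open>p\<close>.\<close>

lemma exists_power_div_neq_1:
  assumes "prime p" "p dvd 2 * M"
  obtains z :: 'a where "z \<noteq> 0" "z ^ (2 * M div p) \<noteq> 1"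
proof -
  have "0 < 2 * M div p"
    using assms M_pos by (metis dvd_div_eq_0_iff gr0I mult_eq_0_iff not_less_iff_gr_or_eq zero_neq_numeral)
  moreover have "2 * M div p < 2 * M"
    using assms M_pos prime_gt_1_nat by (intro div_less_dividend) auto
  ultimately show ?thesis
    using exists_power_neq_1[of "2 * M div p"] that two_M by metis
qed

lemma exists_nonsquare:
  obtains x :: 'a where "x ^ M = -1" "x ^ M \<noteq> 1" "x \<noteq> 0"
proof -
  obtain x :: 'a where "x \<noteq> 0" "x ^ M \<noteq> 1"
    using exists_power_div_neq_1[of 2] by auto
  then show ?thesis
    using power_M_cases that by metis
qed

lemma neg_one_neq_1: "(-1 :: 'a) \<noteq> 1"
  using exists_nonsquare by metis

lemma two_nonzero: "(2 :: 'a) \<noteq> 0"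
  using neg_one_neq_1 by (metis add_eq_0_iff one_add_one)

lemma power_q: "x ^ q = x ^ (q - 1) * x" for x :: 'a
  using q_gt_1 by (metis mult.commute power_minus_mult zero_less_one order.strict_trans)

text \<open>2 lies in the prime field, hence is fixed by Frobenius; writing it as
  \<open>1 - (-1)\<close> exploits that \<open>q\<close> is odd.\<close>

lemma two_power: "(2 :: 'a) ^ (q - 1) = 1"
proof -
  have "(2 :: 'a) ^ q = (1 - (-1)) ^ q"
    by simp
  also have "\<dots> = 2"
    using odd_q by (simp only: diff_power_primepow[OF primepow_q card_eq]) simp
  finally show ?thesis
    using two_nonzero by (simp add: power_q)
qed

lemma F_0: "F 0 = 0"
  using r_pos by (simp add: F_eq)

lemma F_eq_M: "F x = x ^ r * (2 * d + x ^ ((q - 1) * u) * (x ^ M - 1))"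
  unfolding M_def by (rule F_eq)

lemma F_square: "x ^ M = 1 \<Longrightarrow> F x = 2 * d * x ^ r"
  by (simp add: F_eq_M)

lemma F_nonsquare: "x ^ M = -1 \<Longrightarrow> F x = 2 * x ^ r * (d - x ^ ((q - 1) * u))"
  by (simp add: F_eq_M algebra_simps)

text \<open>If the factor vanished, \<open>m\<close>-th powers would give
  \<open>1 = (-1) ^ u\<close>, impossible for odd \<open>u\<close>.\<close>

lemma nonsquare_factor_nonzero:
  assumes "x ^ M = -1"
  shows "d - x ^ ((q - 1) * u) \<noteq> 0"
proof
  assume "d - x ^ ((q - 1) * u) = 0"
  then have "d ^ m = (x ^ M) ^ u"
    by (simp add: M_eq mult_ac flip: power_mult)
  then show False
    using assms odd_u d_power_m neg_one_neq_1 by simp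
qed

lemma F_nonzero:
  assumes "x \<noteq> 0"
  shows "F x \<noteq> 0"
  using power_M_cases[OF assms]
  by cases (use assms d_nonzero two_nonzero nonsquare_factor_nonzero F_square F_nonsquare in auto)

lemma frobenius_root_of_unity:
  fixes y :: 'a
  assumes "y ^ (2 * m) = 1"
  shows "y ^ q * y = 1"
  using assms by (metis two_m power_add power_one_right)

lemma F_nonsquare_power:
  assumes "x ^ M = -1"
  shows "F x ^ (q - 1) * (d * x ^ ((q - 1) * u)) = - (x ^ ((q - 1) * r))"
proof -
  define y where "y = x ^ ((q - 1) * u)"
  define A where "A = d - y"
  have x: "x \<noteq> 0"
    using assms M_pos by (metis neg_equal_0_iff_equal zero_neq_one zero_power)
  have "y ^ (2 * m) = (x ^ (2 * M)) ^ u"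
    by (simp add: y_def M_eq mult_ac flip: power_mult)
  then have y: "y ^ q * y = 1"
    using power_2M[OF x] by (intro frobenius_root_of_unity) simp
  have d: "d ^ q * d = 1"
    using d_power_m by (intro frobenius_root_of_unity) (metis mult.commute power_mult power_one)
  have A: "A \<noteq> 0"
    using nonsquare_factor_nonzero[OF assms] by (simp add: A_def y_def)
  \<comment> \<open>Frobenius inverts \<open>d\<close> and \<open>y\<close>, so \<open>A ^ q\<close>
    is \<open>1/d - 1/y = -A / (d * y)\<close>; the denominator is kept multiplied out.\<close>
  have "A ^ q * (d * y) = (d ^ q * d) * y - (y ^ q * y) * d"
    unfolding A_def by (simp add: diff_power_primepow[OF primepow_q card_eq] algebra_simps)
  then have "A ^ q * (d * y) = - A"
    by (simp add: y d A_def)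
  then have "A * (A ^ (q - 1) * (d * y)) = A * -1"
    unfolding power_q by (simp add: mult_ac)
  then have A_power: "A ^ (q - 1) * (d * y) = -1"
    using A mult_left_cancel by blast
  have "F x = 2 * x ^ r * A"
    using F_nonsquare[OF assms] by (simp add: A_def y_def)
  then have "F x ^ (q - 1) * (d * y) = (x ^ r) ^ (q - 1) * (A ^ (q - 1) * (d * y))"
    using two_power by (simp add: power_mult_distrib mult_ac)
  also have "\<dots> = - (x ^ ((q - 1) * r))"
    unfolding A_power by (simp add: mult.commute flip: power_mult)
  finally show ?thesis
    by (simp add: y_def)
qed

section \<open>Necessity of the two gcd conditions\<close>

lemma coprime_of_inj:
  assumes "inj F"
  shows "coprime r M"
proof (rule ccontr)
  assume "\<not> coprime r M"
  then obtain p where p: "prime p" "p dvd r" "p dvd M"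
    by (metis coprime_iff_gcd_eq_1 gcd_greatest_iff prime_factor_nat)
  then have dvd: "p dvd 2 * M"
    by simp
  then obtain z :: 'a where z: "z \<noteq> 0" "z ^ (2 * M div p) \<noteq> 1"
    using exists_power_div_neq_1 p by blast
  \<comment> \<open>\<open>w\<close> has order \<open>p\<close>, a common divisor of
    \<open>r\<close> and \<open>M\<close>, so it is a square that collides with 1.\<close>
  define w where "w = z ^ (2 * M div p)"
  have "w ^ p = 1"
    using dvd power_2M[OF z(1)] by (simp add: w_def flip: power_mult)
  then have "w ^ r = 1" "w ^ M = 1"
    using p by (metis dvd_def power_mult power_one)+
  then have "F w = F 1"
    by (simp add: F_square)
  then show False
    using assms z by (auto simp: w_def dest: injD)
qed

text \<open>
  A nonsquare \<open>x\<close> and \<open>x z\<close>, where \<open>z\<^bsup>q-1\<^esup>\<close> is a nontrivial root of unity of order dividing \<open>r - u\<close>,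
  have values with equal \<open>(q-1)\<close>-th powers; a factor \<open>s\<close> from the subfield of order \<open>q\<close> then makes
  the values equal, because \<open>r\<close> is coprime to \<open>q - 1\<close>.
\<close>
lemma coprime_diff_of_inj:
  assumes "inj F"
  shows "coprime (int r - int u) (int m)"
proof (rule ccontr)
  assume "\<not> coprime (int r - int u) (int m)"
  then have "gcd (int r - int u) (int m) \<noteq> 1"
    by (simp add: coprime_iff_gcd_eq_1)
  then obtain p where p: "prime p" "int p dvd gcd (int r - int u) (int m)"
    using prime_factor_nat[of "nat (gcd (int r - int u) (int m))"]
    by (metis gcd_ge_0_int int_dvd_int_iff int_nat_eq nat_eq_iff2 of_nat_1)
  then have pru: "int p dvd int r - int u" and "p dvd m"
    by auto
  then obtain k where k: "m = p * k"
    by blast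
  have pM: "p dvd 2 * M"
    by (simp add: M_eq k)
  obtain z0 :: 'a where z0: "z0 \<noteq> 0" "z0 ^ (2 * M div p) \<noteq> 1"
    using exists_power_div_neq_1 p pM by blast
  \<comment> \<open>The factor 2 makes \<open>z\<close> a square, so \<open>x * z\<close> stays a
    nonsquare; the factor \<open>k\<close> makes \<open>z ^ (q - 1)\<close> equal to
    \<open>z0 ^ (2 * M div p)\<close>, of order \<open>p\<close>.\<close>
  define z where "z = z0 ^ (2 * k)"
  define w where "w = z ^ (q - 1)"
  have z: "z \<noteq> 0"
    using z0 by (simp add: z_def)
  have "2 * M = p * (2 * k * (q - 1))"
    by (simp add: M_eq k)
  then have "2 * M div p = 2 * k * (q - 1)"
    using p(1) by (simp add: prime_gt_0_nat)
  then have w: "w \<noteq> 1"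
    using z0 by (simp add: w_def z_def flip: power_mult)
  have zM: "z ^ M = 1"
  proof -
    have "z ^ M = (z0 ^ (2 * M)) ^ k"
      by (simp add: z_def mult_ac flip: power_mult)
    then show ?thesis
      using power_2M[OF z0(1)] by simp
  qed
  have "w ^ p = (z0 ^ (2 * M))"
    by (simp add: w_def z_def M_eq k mult_ac flip: power_mult)
  then have wp: "w ^ p = 1"
    using power_2M[OF z0(1)] by simp
  have wru: "w ^ r = w ^ u"
  proof -
    obtain i where "int r - int u = int p * i"
      using pru by blast
    then have "w powi (int r - int u) = 1"
      using wp by (simp add: power_int_mult)
    then show ?thesis
      using z by (simp add: power_int_diff w_def)
  qed
  obtain x :: 'a where x: "x ^ M = -1" "x \<noteq> 0"
    by (rule exists_nonsquare)
  have xz: "(x * z) ^ M = -1"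
    using x zM by (simp add: power_mult_distrib)
  have "F (x * z) ^ (q - 1) * (d * x ^ ((q - 1) * u)) * w ^ u
      = - (x ^ ((q - 1) * r)) * w ^ r"
    using F_nonsquare_power[OF xz]
    by (simp add: power_mult_distrib w_def mult_ac flip: power_mult)
  also have "\<dots> = F x ^ (q - 1) * (d * x ^ ((q - 1) * u)) * w ^ u"
    using F_nonsquare_power[OF x(1)] wru by simp
  finally have eq: "F (x * z) ^ (q - 1) = F x ^ (q - 1)"
    using d_nonzero x z by (simp add: w_def)
  define t where "t = F x / F (x * z)"
  have t: "t ^ (q - 1) = 1"
    using eq F_nonzero x z by (simp add: t_def power_divide)
  have "coprime r (q - 1)"
    using coprime_of_inj[OF assms] by (simp add: M_eq)
  \<comment> \<open>\<open>b\<close> inverts \<open>r\<close> modulo \<open>q - 1\<close>, so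
    \<open>t ^ b\<close> is an \<open>r\<close>-th root of \<open>t\<close>.\<close>
  then obtain b j where j: "r * b = 1 + j * (q - 1)"
    using bezout_nat[of r "q - 1"] r_pos
    by (metis add.commute coprime_iff_gcd_eq_1 less_numeral_extra(3) mult.commute)
  define s where "s = t ^ b"
  have "s ^ r = t ^ (r * b)"
    by (simp add: s_def mult.commute flip: power_mult)
  also have "\<dots> = t * (t ^ (q - 1)) ^ j"
    unfolding j by (simp add: mult.commute flip: power_mult)
  finally have sr: "s ^ r = t"
    using t by simp
  have sq: "s ^ (q - 1) = 1"
    using t by (metis mult.commute power_mult power_one s_def)
  then have "s ^ M = 1"
    by (simp add: M_eq power_mult)
  then have xzs: "(x * z * s) ^ M = -1"
    using xz by (simp add: power_mult_distrib)
  \<comment> \<open>The inner factor sees its argument only through its \<open>(q - 1)\<close>-th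
    power, which \<open>s\<close> does not change.\<close>
  have "F (x * z * s) = s ^ r * F (x * z)"
    unfolding F_nonsquare[OF xz] F_nonsquare[OF xzs] power_mult power_mult_distrib sq
    by simp
  then have "F (x * z * s) = F x"
    using F_nonzero x z by (simp add: sr t_def)
  then have "x * z * s = x"
    using assms by (simp add: inj_eq)
  then have "z * s = 1"
    using x by (simp add: mult.assoc)
  then have "w = 1"
    using sq by (metis mult.right_neutral power_mult_distrib power_one w_def)
  then show False
    using w by simp
qed

section \<open>Sufficiency of the two gcd conditions\<close>

lemma inj_of_coprime:
  assumes rM: "coprime r M" and ru: "coprime (int r - int u) (int m)"
  shows "inj F"
proof -
  have "even M"
    using M_eq odd_q by simp
  then have "odd r"
    using rM by (metis coprime_common_divisor odd_one)
  then have "even (int r - int u)"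
    using odd_u by simp
  then have "odd (int m)"
    using ru by (metis coprime_common_divisor odd_one)
  then have odd_m: "odd m"
    by simp
  have nonsquare: "F x ^ M = -1" if x: "x ^ M = -1" for x
  proof -
    \<comment> \<open>Raising to the power \<open>m\<close> turns exponents \<open>q - 1\<close>
      into \<open>M\<close>; oddness of \<open>m\<close> keeps the minus sign on the right.\<close>
    have "(F x ^ (q - 1) * (d * x ^ ((q - 1) * u))) ^ m = F x ^ M * (d ^ m * (x ^ M) ^ u)"
      by (simp add: power_mult_distrib M_eq mult_ac flip: power_mult)
    moreover have "(- (x ^ ((q - 1) * r))) ^ m = - ((x ^ M) ^ r)"
      using odd_m by (simp add: M_eq mult_ac flip: power_mult)
    ultimately have "F x ^ M * (d ^ m * (x ^ M) ^ u) = - ((x ^ M) ^ r)"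
      using F_nonsquare_power[OF x] by metis
    then show ?thesis
      using x odd_u \<open>odd r\<close> d_power_m by (simp add: minus_equation_iff)
  qed
  have square: "F x ^ M = 1" if x: "x ^ M = 1" for x
  proof -
    have "d ^ M = 1"
      using d_power_m by (metis M_eq mult.commute power_mult power_one)
    moreover have "(2 :: 'a) ^ M = 1"
      using two_power by (simp add: M_eq power_mult)
    moreover have "(x ^ r) ^ M = (x ^ M) ^ r"
      by (simp add: mult.commute flip: power_mult)
    ultimately show ?thesis
      unfolding F_square[OF x] power_mult_distrib using x by simp
  qed
  show ?thesis
  proof (rule injI)
    fix x y assume eq: "F x = F y"
    show "x = y"
    proof (cases "x = 0 \<or> y = 0")
      case True
      then show ?thesis
        using eq F_0 F_nonzero by metis
    next
      case False
      define z where "z = x / y"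
      have z: "z \<noteq> 0"
        using False by (simp add: z_def)
      have same: "x ^ M = y ^ M"
        using power_M_cases False eq nonsquare square neg_one_neq_1 by metis
      have zM: "z ^ M = 1"
        using same False by (simp add: z_def power_divide)
      have "x ^ r = y ^ r"
      proof (cases "x ^ M = 1")
        case True
        then show ?thesis
          using eq same d_nonzero two_nonzero F_square by (metis mult_left_cancel no_zero_divisors)
      next
        case nsq: False
        then have x: "x ^ M = -1" and y: "y ^ M = -1"
          using power_M_cases False same by metis+
        \<comment> \<open>Cross-multiplication lets the common value of \<open>F\<close> and
          \<open>d\<close> cancel, leaving \<open>z ^ (q - 1)\<close> with order dividing
          \<open>r - u\<close>; its order also divides \<open>m\<close>.\<close>
        have "F x ^ (q - 1) * (d * x ^ ((q - 1) * u)) * y ^ ((q - 1) * r)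
            = F y ^ (q - 1) * (d * y ^ ((q - 1) * u)) * x ^ ((q - 1) * r)"
          unfolding F_nonsquare_power[OF x] F_nonsquare_power[OF y] by simp
        then have "x ^ ((q - 1) * u) * y ^ ((q - 1) * r) = y ^ ((q - 1) * u) * x ^ ((q - 1) * r)"
          using eq F_nonzero[of y] d_nonzero False by (simp add: mult_ac)
        then have "(z ^ (q - 1)) ^ r = (z ^ (q - 1)) ^ u"
          using False by (simp add: z_def power_divide field_simps flip: power_mult)
        then have "(z ^ (q - 1)) powi (int r - int u) = 1"
          using z by (simp add: power_int_diff)
        moreover have "(z ^ (q - 1)) powi (int m) = 1"
          using zM by (simp add: M_eq power_mult)
        ultimately have "z ^ (q - 1) = 1"
          using power_int_gcd_eq_1[of "z ^ (q - 1)" "int r - int u" "int m"] ru z by simp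
        \<comment> \<open>The inner factors at \<open>x\<close> and \<open>y\<close> now agree and
          cancel from \<open>F x = F y\<close>.\<close>
        then have "x ^ (q - 1) = y ^ (q - 1)"
          using False by (simp add: z_def power_divide)
        then have "x ^ ((q - 1) * u) = y ^ ((q - 1) * u)"
          by (simp add: power_mult)
        then show ?thesis
          using eq F_nonsquare[OF x] F_nonsquare[OF y] nonsquare_factor_nonzero[OF y] two_nonzero
          by simp
      qed
      then have "z ^ r = 1"
        using False by (simp add: z_def power_divide)
      then have "z = 1"
        using zM rM z by (rule power_coprime_eq_1)
      then show ?thesis
        using False by (simp add: z_def)
    qed
  qed
qed

theorem bij_iff: "bij F \<longleftrightarrow> coprime r M \<and> coprime (int r - int u) (int m)"
proof -
  have "bij F \<longleftrightarrow> inj F"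
    using finite_UNIV_inj_surj[OF finite, of F] unfolding bij_def by blast
  then show ?thesis
    using coprime_of_inj coprime_diff_of_inj inj_of_coprime by blast
qed

end

section \<open>From the polynomial to the map\<close>

theorem theorem1p6:
  fixes q r u v :: nat and c :: "'a :: {field, finite}" and h f :: "'a poly"
  assumes "primepow q" and "[q = 1] (mod 2)"
    and "CARD('a) = q ^ 2"
    and "(c / 2) ^ ((q + 1) div 2) = 1"
    and "r > 0" and "u > 0" and "v > 0" and "odd u" and "odd v"
    and "h = [:c:] + Polynomial.monom 1 u * (Polynomial.monom 1 ((q + 1) div 2 * v) - 1)"
    and "f = Polynomial.monom 1 r * pcompose h (Polynomial.monom 1 (q - 1))"
  shows "permutation_poly f \<longleftrightarrow>
    gcd r ((q ^ 2 - 1) div 2) = 1 \<and> gcd (int r - int u) ((int q + 1) div 2) = 1"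
proof -
  define F where "F x = x ^ r * (2 * (c / 2) + x ^ ((q - 1) * u) * (x ^ ((q ^ 2 - 1) div 2) - 1))"
    for x :: 'a
  interpret binomial_type_map q r u "c / 2" F
    using assms by unfold_locales (auto simp: F_def cong_def odd_iff_mod_2_eq_one)
  have "poly f x = F x" for x
  proof (cases "x = 0")
    case True
    then show ?thesis
      using assms by (simp add: F_def poly_monom)
  next
    case False
    \<comment> \<open>An odd power fixes both 1 and -1, so \<open>v\<close> disappears from the
      exponent.\<close>
    have "(x ^ (q - 1)) ^ (m * v) = (x ^ M) ^ v"
      by (simp add: M_eq mult_ac flip: power_mult)
    also have "\<dots> = x ^ M"
      using power_M_cases[OF False] by cases (use assms in auto)
    finally have "(x ^ (q - 1)) ^ ((q + 1) div 2 * v) = x ^ M"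
      by (simp only: m_def)
    then show ?thesis
      \<comment> \<open>Needed to turn \<open>2 * (c / 2)\<close> back into
        \<open>c\<close>.\<close>
      using two_nonzero
      by (simp add: assms(10,11) F_eq_M poly_pcompose poly_monom power_mult)
  qed
  then have "poly f = F"
    by blast
  moreover have "(int q + 1) div 2 = int m"
    by (simp add: m_def zdiv_int)
  ultimately show ?thesis
    using bij_iff by (simp add: permutation_poly_def coprime_iff_gcd_eq_1 M_def)
qed

end
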